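(* Let $w$ be the velocity trajectory, on $[0,\infty)$, of the system $J\dot w=-F+u$ with LuGre friction $$\dot z = w-\sigma_0\frac{|w|}{h(w)}z,\qquad F=\sigma_0 z+\sigma_1\dot z+F_v w,\qquad h(w)=F_c+(F_s-F_c)e^{-(w/w_s)^2},$$ for an arbitrary input $u$, and consider the observer $$\dot{\hat z}=w-\sigma_0\frac{|w|}{h(w)}\hat z+K_1(w-\hat w),\qquad J\dot{\hat w}=-\sigma_0\hat z-\sigma_1\dot{\hat z}-F_v w+u+K_2(w-\hat w).$$ Assume that $w\in L_\infty$, with $|w(t)|\le M$ for all $t\ge 0$ for some $M>0$. Let $A>0$, $C>0$, $\alpha>0$ be arbitrary constants, let $C_1=\min\{F_s,F_c\}$, and choose the (time-varying) gain $K_1$ and the constant gain $K_2$ as $$K_1=\frac{C\sigma_0}{AJ}\left(\sigma_1\frac{|w|}{h(w)}-1\right),\qquad K_2=\alpha+\frac{C}{AJ}\sigma_0\sigma_1\left(\sigma_1\frac{M}{C_1}-1\right).$$ Then the estimation errors $e_z=z-\hat z$ and $e_w=w-\hat w$ satisfy $e_w,e_z\in L_2$. Moreover, the error dynamics is asymptotically stable, i.e. $e_w(t)\to 0$ and $e_z(t)\to 0$ as $t\to\infty$ (for every initial condition).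
   Context: All functions are real-valued functions of time $t\ge 0$; $L_\infty$ and $L_2$ denote the spaces of bounded, respectively square-integrable, functions on $[0,\infty)$. The constants $J$ (inertia), $\sigma_0$ (stiffness), $\sigma_1$ (damping), $F_c$ (Coulomb friction), $F_s$ (stiction), $w_s$ (Stribeck velocity) are positive, and $F_v$ (viscous coefficient) is a known constant. The velocity $w$ is measured; the internal state $z$ is not. The trajectories $w,z$ are assumed to exist on $[0,\infty)$. The error dynamics are the linear time-varying system (with $w=w(t)$ regarded as a given signal) $$\dot e_z=-\sigma_0\frac{|w|}{h(w)}e_z-K_1e_w,\qquad \dot e_w=-\frac{\sigma_0}{J}e_z+\frac{\sigma_0\sigma_1}{J}\frac{|w|}{h(w)}e_z-K_3e_w,\qquad K_3=\frac{K_2-\sigma_1K_1}{J}.$$ *)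

theory Defs
  imports "HOL-Analysis.Analysis"
begin

definition L_inf :: "(real \<Rightarrow> real) set" where
  "L_inf = {f. bounded (f ` {0..})}"

definition L_2 :: "(real \<Rightarrow> real) set" where
  "L_2 = {f. set_borel_measurable lborel {0..} f \<and> set_integrable lborel {0..} (\<lambda>t. (f t)\<^sup>2)}"

definition stribeck :: "real \<Rightarrow> real \<Rightarrow> real \<Rightarrow> real \<Rightarrow> real" where
  "stribeck Fc Fs ws v = Fc + (Fs - Fc) * exp (- ((v / ws)\<^sup>2))"

text \<open>Trajectories below are classical solutions on the closed half-line, with the one-sided
  derivative at time 0; \<open>dz\<close>, \<open>dw\<close>, \dots denote the time derivatives. Initial values
  are left unconstrained.\<close>

definition lugre_system ::
  "real \<Rightarrow> real \<Rightarrow> real \<Rightarrow> real \<Rightarrow> (real \<Rightarrow> real) \<Rightarrow>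
   (real \<Rightarrow> real) \<Rightarrow> (real \<Rightarrow> real) \<Rightarrow> (real \<Rightarrow> real) \<Rightarrow> bool" where
  "lugre_system J \<sigma>0 \<sigma>1 Fv h u w z \<longleftrightarrow>
    (\<exists>dz dw F. \<forall>t\<ge>0.
      (z has_real_derivative dz t) (at t within {0..}) \<and>
      (w has_real_derivative dw t) (at t within {0..}) \<and>
      dz t = w t - \<sigma>0 * (\<bar>w t\<bar> / h (w t)) * z t \<and>
      F t = \<sigma>0 * z t + \<sigma>1 * dz t + Fv * w t \<and>
      J * dw t = - F t + u t)"

definition lugre_observer ::
  "real \<Rightarrow> real \<Rightarrow> real \<Rightarrow> real \<Rightarrow> (real \<Rightarrow> real) \<Rightarrow> (real \<Rightarrow> real) \<Rightarrow> real \<Rightarrow>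
   (real \<Rightarrow> real) \<Rightarrow> (real \<Rightarrow> real) \<Rightarrow> (real \<Rightarrow> real) \<Rightarrow> (real \<Rightarrow> real) \<Rightarrow> bool" where
  "lugre_observer J \<sigma>0 \<sigma>1 Fv h K1 K2 u w zh wh \<longleftrightarrow>
    (\<exists>dzh dwh. \<forall>t\<ge>0.
      (zh has_real_derivative dzh t) (at t within {0..}) \<and>
      (wh has_real_derivative dwh t) (at t within {0..}) \<and>
      dzh t = w t - \<sigma>0 * (\<bar>w t\<bar> / h (w t)) * zh t + K1 t * (w t - wh t) \<and>
      J * dwh t = - \<sigma>0 * zh t - \<sigma>1 * dzh t - Fv * w t + u t + K2 * (w t - wh t))"

definition error_dynamics ::
  "real \<Rightarrow> real \<Rightarrow> real \<Rightarrow> (real \<Rightarrow> real) \<Rightarrow> (real \<Rightarrow> real) \<Rightarrow> real \<Rightarrow>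
   (real \<Rightarrow> real) \<Rightarrow> (real \<Rightarrow> real) \<Rightarrow> (real \<Rightarrow> real) \<Rightarrow> bool" where
  "error_dynamics J \<sigma>0 \<sigma>1 h K1 K2 w ez ew \<longleftrightarrow>
    (\<exists>dez dew K3. \<forall>t\<ge>0.
      (ez has_real_derivative dez t) (at t within {0..}) \<and>
      (ew has_real_derivative dew t) (at t within {0..}) \<and>
      K3 t = (K2 - \<sigma>1 * K1 t) / J \<and>
      dez t = - \<sigma>0 * (\<bar>w t\<bar> / h (w t)) * ez t - K1 t * ew t \<and>
      dew t = - (\<sigma>0 / J) * ez t + (\<sigma>0 * \<sigma>1 / J) * (\<bar>w t\<bar> / h (w t)) * ez t - K3 t * ew t)"

end

theory Submission imports Defs begin

text \<open>Write \<open>g = |w| / h(w)\<close>. With the prescribed gains, \<open>V = d ez\<^sup>2 + c ew\<^sup>2\<close>, where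
  \<open>d = \<sigma>0 / J\<close> and \<open>c = C \<sigma>0 / (A J)\<close>, satisfies
  \<open>V' = -2 \<sigma>0 d g ez\<^sup>2 - 2 c K3 ew\<^sup>2\<close>, and \<open>K3 \<ge> \<alpha> / J\<close>. The damping of \<open>ez\<close> vanishes whenever
  \<open>w = 0\<close>, so \<open>V\<close> alone does not control \<open>ez\<close>. The cross term \<open>ez ew\<close> repairs this: its derivative
  contains \<open>d (\<sigma>1 g - 1) ez\<^sup>2\<close>, whose negative part does not depend on \<open>w\<close> and whose positive part
  is dominated by the damping \<open>g ez\<^sup>2\<close>. Hence \<open>V + \<epsilon> ez ew\<close> decays exponentially for small
  \<open>\<epsilon> > 0\<close>.\<close>

section \<open>Exponential decay and its consequences\<close>

text \<open>The integrating factor \<open>exp (r * t)\<close> turns the differential inequality into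
  monotonicity of \<open>W t * exp (r * t)\<close>.\<close>

lemma exponential_decay_of_deriv_le:
  fixes W W' :: "real \<Rightarrow> real"
  assumes der: "\<And>t. t \<ge> 0 \<Longrightarrow> (W has_real_derivative W' t) (at t within {0..})"
    and le: "\<And>t. t \<ge> 0 \<Longrightarrow> W' t \<le> - r * W t"
    and "t \<ge> 0"
  shows "W t \<le> W 0 * exp (- r * t)"
proof -
  let ?E = "\<lambda>t. W t * exp (r * t)"
  have derE: "(?E has_real_derivative (W' t + r * W t) * exp (r * t)) (at t within {0..})"
    if "t \<ge> 0" for t
    by (rule derivative_eq_intros der that refl | simp add: algebra_simps)+
  have "?E t \<le> ?E 0"
  proof (rule DERIV_nonpos_imp_decreasing_open[OF \<open>t \<ge> 0\<close>])
    fix x assume x: "0 < x" "x < t"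
    \<comment> \<open>At interior points the derivative within the half-line is two-sided; at the
      endpoints continuity of \<open>?E\<close> suffices.\<close>
    have "at x within {0..} = at x"
      using x by (intro at_within_interior) (simp add: interior_real_atLeast)
    then have "(?E has_real_derivative (W' x + r * W x) * exp (r * x)) (at x)"
      using derE[of x] x by simp
    moreover have "(W' x + r * W x) * exp (r * x) \<le> 0"
      using le[of x] x by (intro mult_nonpos_nonneg) auto
    ultimately show "\<exists>y. DERIV ?E x :> y \<and> y \<le> 0" by blast
  next
    have "continuous_on {0..} ?E"
      by (rule DERIV_continuous_on[OF derE]) simp
    then show "continuous_on {0..t} ?E"
      by (rule continuous_on_subset) auto
  qed
  then show ?thesis
    by (simp add: exp_minus field_simps)
qed

lemma quadratic_decay_imp_tendsto_0:
  fixes f :: "real \<Rightarrow> real"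
  assumes "r > 0" and bound: "\<And>t. t \<ge> 0 \<Longrightarrow> (f t)\<^sup>2 \<le> B * exp (- r * t)"
  shows "(f \<longlongrightarrow> 0) at_top"
proof -
  have "filterlim (\<lambda>t. r * t) at_top at_top"
    using \<open>r > 0\<close> by (intro filterlim_tendsto_pos_mult_at_top[OF tendsto_const] filterlim_ident)
  then have "((\<lambda>t. exp (- (r * t))) \<longlongrightarrow> 0) at_top"
    by (intro filterlim_compose[OF exp_at_bot] filterlim_compose[OF filterlim_uminus_at_bot_at_top])
  then have "((\<lambda>t. B * exp (- r * t)) \<longlongrightarrow> 0) at_top"
    using tendsto_mult_right_zero by fastforce
  then have "((\<lambda>t. (f t)\<^sup>2) \<longlongrightarrow> 0) at_top"
    by (rule tendsto_sandwich[OF _ _ tendsto_const, rotated 2])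
       (auto intro!: always_eventually eventually_mono[OF eventually_ge_at_top[of 0]] bound[simplified])
  from tendsto_real_sqrt[OF this] show ?thesis
    by (simp add: tendsto_rabs_zero_iff)
qed

text \<open>The square is dominated by an integrable exponential; continuity supplies the
  measurability.\<close>

lemma quadratic_decay_imp_L_2:
  fixes f :: "real \<Rightarrow> real"
  assumes "r > 0" and bound: "\<And>t. t \<ge> 0 \<Longrightarrow> (f t)\<^sup>2 \<le> B * exp (- r * t)"
    and cont: "continuous_on {0..} f"
  shows "f \<in> L_2"
proof -
  \<comment> \<open>Gauge integrability on the half-line becomes absolute by nonnegativity; Borel
    measurability then allows passing from the completed measure to \<open>lborel\<close>.\<close>
  have "(\<lambda>t. exp (- r * t)) absolutely_integrable_on {0..}"
    using \<open>r > 0\<close> by (intro nonnegative_absolutely_integrable_1 integrable_on_exp_minus_to_infinity) auto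
  then have "set_integrable lborel {0..} (\<lambda>t. exp (- r * t))"
    unfolding set_integrable_def by (subst (asm) integrable_completion) measurable
  then have "set_integrable lborel {0..} (\<lambda>t. B * exp (- r * t))"
    by simp
  moreover have "set_borel_measurable lborel {0..} (\<lambda>t. (f t)\<^sup>2)"
    using set_measurable_continuous_on[of "{0..}" "\<lambda>t. (f t)\<^sup>2"] cont
    by (simp add: set_borel_measurable_def continuous_on_power)
  moreover have "AE t in lborel. t \<in> {0..} \<longrightarrow> norm ((f t)\<^sup>2) \<le> norm (B * exp (- r * t))"
    using order_trans[OF bound abs_ge_self] by (intro AE_I2) simp
  ultimately have "set_integrable lborel {0..} (\<lambda>t. (f t)\<^sup>2)"
    by (rule set_integrable_bound)
  moreover have "set_borel_measurable lborel {0..} f"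
    using set_measurable_continuous_on[of "{0..}" f] cont
    by (simp add: set_borel_measurable_def)
  ultimately show ?thesis
    by (simp add: L_2_def)
qed

text \<open>The value is a convex combination of \<open>Fs\<close> and \<open>Fc\<close> with
  weights \<open>e\<close> and \<open>1 - e\<close>, whichever of the two is larger.\<close>

lemma stribeck_ge_min: "min Fs Fc \<le> stribeck Fc Fs ws v"
proof -
  define e where "e = exp (- ((v / ws)\<^sup>2))"
  have e: "0 \<le> e" "0 \<le> 1 - e" by (auto simp: e_def)
  have "min Fs Fc * e + min Fs Fc * (1 - e) \<le> Fs * e + Fc * (1 - e)"
    by (intro add_mono mult_right_mono e) auto
  then show ?thesis
    by (simp add: stribeck_def e_def[symmetric] algebra_simps)
qed

text \<open>Young's inequality, weighted to cost exactly \<open>p / 2\<close> on the square of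
  \<open>x\<close>. With \<open>p = d\<close> it uses up half of the decay produced by the cross
  term.\<close>

lemma mult_le_quadratic:
  fixes p q x y :: real
  assumes "p > 0"
  shows "q * (x * y) \<le> p / 2 * x\<^sup>2 + q\<^sup>2 / (2 * p) * y\<^sup>2"
proof -
  have "0 \<le> (p * x - q * y)\<^sup>2 / (2 * p)" using assms by simp
  also have "\<dots> = p / 2 * x\<^sup>2 + q\<^sup>2 / (2 * p) * y\<^sup>2 - q * (x * y)"
    using assms by (simp add: power2_eq_square field_simps)
  finally show ?thesis by simp
qed

lemma abs_mult_le_sum_squares: "2 * \<bar>x * y\<bar> \<le> x\<^sup>2 + y\<^sup>2" for x y :: real
  using sum_squares_bound[of "\<bar>x\<bar>" "\<bar>y\<bar>"] by (simp add: abs_mult)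

section \<open>Strict Lyapunov function for the abstract error system\<close>

text \<open>Both couplings are multiples of \<open>s * g t - 1\<close>, by \<open>- c\<close> and
  \<open>d\<close>, so the weights \<open>d\<close> and \<open>c\<close> on the squares of
  \<open>x\<close> and \<open>y\<close> cancel them. The bounds \<open>G\<close> and
  \<open>K\<close> control the mixed terms created by the product \<open>x t * y t\<close>.\<close>

lemma degenerate_damping_exponential_decay:
  fixes x y x' y' g k :: "real \<Rightarrow> real" and a c d s \<kappa> G K :: real
  assumes pos: "a > 0" "c > 0" "d > 0" "s > 0" "\<kappa> > 0"
    and derx: "\<And>t. t \<ge> 0 \<Longrightarrow> (x has_real_derivative x' t) (at t within {0..})"
    and dery: "\<And>t. t \<ge> 0 \<Longrightarrow> (y has_real_derivative y' t) (at t within {0..})"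
    and x': "\<And>t. t \<ge> 0 \<Longrightarrow> x' t = - a * g t * x t - c * (s * g t - 1) * y t"
    and y': "\<And>t. t \<ge> 0 \<Longrightarrow> y' t = d * (s * g t - 1) * x t - k t * y t"
    and g: "\<And>t. t \<ge> 0 \<Longrightarrow> 0 \<le> g t" "\<And>t. t \<ge> 0 \<Longrightarrow> g t \<le> G"
    and k: "\<And>t. t \<ge> 0 \<Longrightarrow> \<kappa> \<le> k t" "\<And>t. t \<ge> 0 \<Longrightarrow> k t \<le> K"
  obtains B r where "r > 0" and "\<And>t. t \<ge> 0 \<Longrightarrow> (x t)\<^sup>2 + (y t)\<^sup>2 \<le> B * exp (- r * t)"
proof -
  \<comment> \<open>\<open>N\<close> bounds the coefficient of the square of \<open>y\<close> in the
    derivative of \<open>x t * y t\<close>: \<open>c\<close> from the coupling, the rest from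
    Young's inequality.\<close>
  define N where "N = c + (a * G + K)\<^sup>2 / (2 * d)"
  have "N > 0" using pos by (auto simp: N_def intro!: add_pos_nonneg)
  \<comment> \<open>The first bound lets the damping of \<open>x\<close> absorb the positive
    \<open>g\<close> term, the second spends at most half of the damping of \<open>y\<close>, and
    the last two keep \<open>W\<close> positive definite.\<close>
  define \<epsilon> where "\<epsilon> = min (min (2 * a / s) (c * \<kappa> / N)) (min c d)"
  have \<epsilon>: "\<epsilon> > 0" "\<epsilon> \<le> c" "\<epsilon> \<le> d" using pos \<open>N > 0\<close> by (auto simp: \<epsilon>_def)
  have "\<epsilon> \<le> 2 * a / s" "\<epsilon> \<le> c * \<kappa> / N" by (auto simp: \<epsilon>_def)
  then have \<epsilon>s: "\<epsilon> * s \<le> 2 * a" and \<epsilon>N: "\<epsilon> * N \<le> c * \<kappa>"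
    using pos \<open>N > 0\<close> by (auto simp: field_simps)
  define S where "S = (\<lambda>t. (x t)\<^sup>2 + (y t)\<^sup>2)"
  define W where "W = (\<lambda>t. d * (x t)\<^sup>2 + c * (y t)\<^sup>2 + \<epsilon> * (x t * y t))"
  define W' where "W' = (\<lambda>t. 2 * d * x t * x' t + 2 * c * y t * y' t + \<epsilon> * (x' t * y t + x t * y' t))"
  \<comment> \<open>\<open>W\<close> lies between \<open>m * S\<close> and \<open>L * S\<close>, and
    \<open>W'\<close> is at most \<open>- \<rho> * S\<close>; hence the rate
    \<open>\<rho> / L\<close>.\<close>
  define m L \<rho> where "m = min c d / 2" and "L = c + d + \<epsilon>" and "\<rho> = min (\<epsilon> * d / 2) (c * \<kappa>)"
  have pos': "m > 0" "L > 0" "\<rho> > 0" using pos \<epsilon> by (auto simp: m_def L_def \<rho>_def)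
  have derW: "(W has_real_derivative W' t) (at t within {0..})" if "t \<ge> 0" for t
    unfolding W_def W'_def
    by (rule derivative_eq_intros derx dery that refl | simp add: algebra_simps)+
  have W_lower: "m * S t \<le> W t" for t
  proof -
    have "\<epsilon> * \<bar>x t * y t\<bar> \<le> min c d * (S t / 2)"
      using \<epsilon> pos abs_mult_le_sum_squares[of "x t" "y t"]
      by (intro mult_mono) (auto simp: S_def)
    moreover have "- (\<epsilon> * (x t * y t)) \<le> \<epsilon> * \<bar>x t * y t\<bar>"
      using \<epsilon> by (metis abs_ge_minus_self abs_mult abs_of_pos)
    moreover have "min c d * (x t)\<^sup>2 + min c d * (y t)\<^sup>2 \<le> d * (x t)\<^sup>2 + c * (y t)\<^sup>2"
      by (intro add_mono mult_right_mono) auto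
    ultimately show ?thesis
      by (simp add: W_def m_def S_def algebra_simps)
  qed
  have W_upper: "W t \<le> L * S t" for t
  proof -
    have "\<epsilon> * (x t * y t) \<le> \<epsilon> * S t"
      using \<epsilon> abs_mult_le_sum_squares[of "x t" "y t"] abs_ge_self[of "x t * y t"]
      unfolding S_def by (intro mult_left_mono) linarith+
    moreover have "0 \<le> c * (x t)\<^sup>2" "0 \<le> d * (y t)\<^sup>2" using pos by auto
    ultimately show ?thesis
      by (simp add: W_def L_def S_def algebra_simps)
  qed
  have W'_le: "W' t \<le> - (\<rho> / L) * W t" if t: "t \<ge> 0" for t
  proof -
    have cross: "x' t * y t + x t * y' t \<le> - (d / 2) * (x t)\<^sup>2 + d * s * (g t * (x t)\<^sup>2) + N * (y t)\<^sup>2"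
    proof -
      have "- (a * g t + k t) * (x t * y t)
          \<le> d / 2 * (x t)\<^sup>2 + (- (a * g t + k t))\<^sup>2 / (2 * d) * (y t)\<^sup>2"
        by (rule mult_le_quadratic) fact
      also have "\<dots> \<le> d / 2 * (x t)\<^sup>2 + (a * G + K)\<^sup>2 / (2 * d) * (y t)\<^sup>2"
      proof -
        have "(a * g t + k t)\<^sup>2 \<le> (a * G + K)\<^sup>2"
          using pos g[OF t] k[OF t] by (intro power_mono add_mono mult_left_mono) auto
        then show ?thesis
          unfolding power2_minus using pos
          by (intro add_left_mono mult_right_mono divide_right_mono) auto
      qed
      finally have "- (a * g t + k t) * (x t * y t) \<le> \<dots>" .
      moreover have "0 \<le> c * s * g t * (y t)\<^sup>2" using pos g[OF t] by auto
      ultimately show ?thesis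
        unfolding x'[OF t] y'[OF t] N_def
        by (simp add: algebra_simps power2_eq_square)
    qed
    \<comment> \<open>The terms with \<open>2 * c * d * (s * g t - 1) * x t * y t\<close> cancel
      here.\<close>
    have "W' t = - (2 * a * d * (g t * (x t)\<^sup>2)) - 2 * c * k t * (y t)\<^sup>2
        + \<epsilon> * (x' t * y t + x t * y' t)"
      unfolding W'_def by (simp add: x'[OF t] y'[OF t] algebra_simps power2_eq_square)
    also have "\<dots> \<le> - (2 * a * d * (g t * (x t)\<^sup>2)) - 2 * c * k t * (y t)\<^sup>2
        + \<epsilon> * (- (d / 2) * (x t)\<^sup>2 + d * s * (g t * (x t)\<^sup>2) + N * (y t)\<^sup>2)"
      using cross \<epsilon> by (intro add_left_mono mult_left_mono) auto
    also have "\<dots> = - (2 * a - \<epsilon> * s) * (d * (g t * (x t)\<^sup>2)) - \<epsilon> * d / 2 * (x t)\<^sup>2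
        - (2 * c * k t - \<epsilon> * N) * (y t)\<^sup>2"
      by (simp add: algebra_simps)
    also have "\<dots> \<le> - (\<rho> * (x t)\<^sup>2) - \<rho> * (y t)\<^sup>2"
    proof -
      have "0 \<le> (2 * a - \<epsilon> * s) * (d * (g t * (x t)\<^sup>2))"
        using \<epsilon>s pos g[OF t] by auto
      moreover have "\<rho> * (x t)\<^sup>2 \<le> \<epsilon> * d / 2 * (x t)\<^sup>2"
        by (intro mult_right_mono) (auto simp: \<rho>_def)
      moreover have "\<rho> * (y t)\<^sup>2 \<le> (2 * c * k t - \<epsilon> * N) * (y t)\<^sup>2"
      proof (intro mult_right_mono)
        have "c * \<kappa> \<le> c * k t" using pos k[OF t] by auto
        moreover have "\<rho> \<le> c * \<kappa>" by (simp add: \<rho>_def)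
        ultimately show "\<rho> \<le> 2 * c * k t - \<epsilon> * N" using \<epsilon>N by linarith
      qed auto
      ultimately show ?thesis by linarith
    qed
    also have "\<dots> = - (\<rho> / L) * (L * S t)"
      using pos' by (simp add: S_def algebra_simps)
    also have "\<dots> \<le> - (\<rho> / L) * W t"
      using W_upper pos' by (intro mult_left_mono_neg) auto
    finally show ?thesis .
  qed
  have "S t \<le> W 0 / m * exp (- (\<rho> / L) * t)" if "t \<ge> 0" for t
    using order_trans[OF W_lower exponential_decay_of_deriv_le[OF derW W'_le that]] pos'
    by (simp add: field_simps)
  then show ?thesis
    using that[of "\<rho> / L" "W 0 / m"] pos' by (simp add: S_def)
qed

section \<open>Error equations of the LuGre observer\<close>

text \<open>The observer is driven by the measured \<open>w\<close>, so \<open>u\<close> and the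
  viscous term cancel on subtraction and the rest is linear in the errors.\<close>

lemma observer_error_dynamics:
  assumes "J > 0"
    and sys: "lugre_system J \<sigma>0 \<sigma>1 Fv h u w z"
    and obs: "lugre_observer J \<sigma>0 \<sigma>1 Fv h K1 K2 u w zh wh"
  shows "error_dynamics J \<sigma>0 \<sigma>1 h K1 K2 w (\<lambda>t. z t - zh t) (\<lambda>t. w t - wh t)"
proof -
  obtain dz dw F where
    z: "\<And>t. t \<ge> 0 \<Longrightarrow> (z has_real_derivative dz t) (at t within {0..})" and
    w: "\<And>t. t \<ge> 0 \<Longrightarrow> (w has_real_derivative dw t) (at t within {0..})" and
    dz: "\<And>t. t \<ge> 0 \<Longrightarrow> dz t = w t - \<sigma>0 * (\<bar>w t\<bar> / h (w t)) * z t" and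
    F: "\<And>t. t \<ge> 0 \<Longrightarrow> F t = \<sigma>0 * z t + \<sigma>1 * dz t + Fv * w t" and
    dw: "\<And>t. t \<ge> 0 \<Longrightarrow> J * dw t = - F t + u t"
    using sys unfolding lugre_system_def by blast
  obtain dzh dwh where
    zh: "\<And>t. t \<ge> 0 \<Longrightarrow> (zh has_real_derivative dzh t) (at t within {0..})" and
    wh: "\<And>t. t \<ge> 0 \<Longrightarrow> (wh has_real_derivative dwh t) (at t within {0..})" and
    dzh: "\<And>t. t \<ge> 0 \<Longrightarrow>
      dzh t = w t - \<sigma>0 * (\<bar>w t\<bar> / h (w t)) * zh t + K1 t * (w t - wh t)" and
    dwh: "\<And>t. t \<ge> 0 \<Longrightarrow>
      J * dwh t = - \<sigma>0 * zh t - \<sigma>1 * dzh t - Fv * w t + u t + K2 * (w t - wh t)"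
    using obs unfolding lugre_observer_def by blast
  have ez: "dz t - dzh t = - \<sigma>0 * (\<bar>w t\<bar> / h (w t)) * (z t - zh t) - K1 t * (w t - wh t)"
    if "t \<ge> 0" for t
    using dz[OF that] dzh[OF that] by (simp add: right_diff_distrib)
  have ew: "dw t - dwh t = - (\<sigma>0 / J) * (z t - zh t)
      + (\<sigma>0 * \<sigma>1 / J) * (\<bar>w t\<bar> / h (w t)) * (z t - zh t)
      - ((K2 - \<sigma>1 * K1 t) / J) * (w t - wh t)" if t: "t \<ge> 0" for t
  proof -
    define g where "g = \<bar>w t\<bar> / h (w t)"
    have "J * (dw t - dwh t) = - \<sigma>0 * (z t - zh t) - \<sigma>1 * (dz t - dzh t) - K2 * (w t - wh t)"
      using dw[OF t] F[OF t] dwh[OF t] by (simp add: algebra_simps)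
    \<comment> \<open>Inserting the equation for the error of \<open>z\<close> into the damping term
      produces \<open>\<sigma>1 * K1 t\<close>, which merges with \<open>K2\<close> into the
      numerator of \<open>K3\<close>.\<close>
    also have "\<dots> = - \<sigma>0 * (z t - zh t) + \<sigma>0 * \<sigma>1 * g * (z t - zh t)
        - (K2 - \<sigma>1 * K1 t) * (w t - wh t)"
      unfolding ez[OF t] g_def[symmetric] by (simp add: algebra_simps)
    finally have "dw t - dwh t = (- \<sigma>0 * (z t - zh t) + \<sigma>0 * \<sigma>1 * g * (z t - zh t)
        - (K2 - \<sigma>1 * K1 t) * (w t - wh t)) / J"
      using \<open>J > 0\<close> by (simp add: eq_divide_eq mult.commute)
    then show ?thesis
      unfolding g_def[symmetric] by (simp add: add_divide_distrib diff_divide_distrib left_diff_distrib)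
  qed
  show ?thesis
    unfolding error_dynamics_def
    by (rule exI[of _ "\<lambda>t. dz t - dzh t"], rule exI[of _ "\<lambda>t. dw t - dwh t"],
        rule exI[of _ "\<lambda>t. (K2 - \<sigma>1 * K1 t) / J"])
       (intro allI impI conjI ez ew refl DERIV_diff z w zh wh; assumption)
qed

text \<open>\<open>K1\<close> is chosen to make the two couplings proportional, and
  \<open>K2\<close> to keep \<open>K3\<close> at least \<open>\<alpha> / J\<close> for all values of
  |w| / h(w) up to \<open>G\<close>.\<close>

lemma error_dynamics_exponential_decay:
  fixes J \<sigma>0 \<sigma>1 c \<alpha> G K2 :: real and h K1 w ez ew :: "real \<Rightarrow> real"
  assumes pos: "J > 0" "\<sigma>0 > 0" "\<sigma>1 > 0" "c > 0" "\<alpha> > 0"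
    and g: "\<And>t. t \<ge> 0 \<Longrightarrow> 0 \<le> \<bar>w t\<bar> / h (w t)" "\<And>t. t \<ge> 0 \<Longrightarrow> \<bar>w t\<bar> / h (w t) \<le> G"
    and K1: "K1 = (\<lambda>t. c * (\<sigma>1 * (\<bar>w t\<bar> / h (w t)) - 1))"
    and K2: "K2 = \<alpha> + c * \<sigma>1 * (\<sigma>1 * G - 1)"
    and err: "error_dynamics J \<sigma>0 \<sigma>1 h K1 K2 w ez ew"
  obtains B r where "r > 0" and "\<And>t. t \<ge> 0 \<Longrightarrow> (ez t)\<^sup>2 + (ew t)\<^sup>2 \<le> B * exp (- r * t)"
proof -
  define g where "g = (\<lambda>t. \<bar>w t\<bar> / h (w t))"
  obtain dez dew K3 where
    ez: "\<And>t. t \<ge> 0 \<Longrightarrow> (ez has_real_derivative dez t) (at t within {0..})" and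
    ew: "\<And>t. t \<ge> 0 \<Longrightarrow> (ew has_real_derivative dew t) (at t within {0..})" and
    K3: "\<And>t. t \<ge> 0 \<Longrightarrow> K3 t = (K2 - \<sigma>1 * K1 t) / J" and
    dez: "\<And>t. t \<ge> 0 \<Longrightarrow> dez t = - \<sigma>0 * g t * ez t - K1 t * ew t" and
    dew: "\<And>t. t \<ge> 0 \<Longrightarrow>
      dew t = - (\<sigma>0 / J) * ez t + (\<sigma>0 * \<sigma>1 / J) * g t * ez t - K3 t * ew t"
    using err unfolding error_dynamics_def g_def by blast
  \<comment> \<open>The \<open>- 1\<close> parts of the two gains cancel. Since \<open>g t\<close>
    lies between 0 and \<open>G\<close>, both bounds on \<open>K3\<close> can be read off.\<close>
  have K3_eq: "K3 t = (\<alpha> + c * \<sigma>1 * \<sigma>1 * (G - g t)) / J" if "t \<ge> 0" for t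
    unfolding K3[OF that] K1 K2 g_def[symmetric] fun_cong[OF g_def, symmetric]
    by (simp add: algebra_simps)
  show ?thesis
  proof (rule degenerate_damping_exponential_decay[of \<sigma>0 c "\<sigma>0 / J" \<sigma>1 "\<alpha> / J" ez dez ew dew g K3 G
        "(\<alpha> + c * \<sigma>1 * \<sigma>1 * G) / J"])
    fix t :: real assume t: "t \<ge> 0"
    show "dez t = - \<sigma>0 * g t * ez t - c * (\<sigma>1 * g t - 1) * ew t"
      using dez[OF t] by (simp add: K1 g_def)
    show "dew t = \<sigma>0 / J * (\<sigma>1 * g t - 1) * ez t - K3 t * ew t"
      using dew[OF t] by (simp add: algebra_simps)
    have "0 \<le> c * \<sigma>1 * \<sigma>1 * (G - g t)" using pos g(2)[OF t] by (simp add: g_def)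
    then show "\<alpha> / J \<le> K3 t" using pos by (simp add: K3_eq[OF t] divide_right_mono)
    have "c * \<sigma>1 * \<sigma>1 * (G - g t) \<le> c * \<sigma>1 * \<sigma>1 * G"
      using pos g(1)[OF t] by (intro mult_left_mono) (auto simp: g_def)
    then show "K3 t \<le> (\<alpha> + c * \<sigma>1 * \<sigma>1 * G) / J"
      using pos by (simp add: K3_eq[OF t] divide_right_mono)
    show "0 \<le> g t" "g t \<le> G" using g[OF t] by (simp_all add: g_def)
  qed (use pos ez ew in \<open>auto intro!: that simp del: mult_minus_left\<close>)
qed

theorem lemma5:
  fixes J \<sigma>0 \<sigma>1 Fc Fs ws Fv A C \<alpha> M C1 K2 :: real
    and h K1 u w z :: "real \<Rightarrow> real"
  assumes "J > 0" and "\<sigma>0 > 0" and "\<sigma>1 > 0" and "Fc > 0" and "Fs > 0" and "ws > 0"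
    and "h = stribeck Fc Fs ws"
    and "lugre_system J \<sigma>0 \<sigma>1 Fv h u w z"
    and "w \<in> L_inf" and "M > 0" and "\<forall>t\<ge>0. \<bar>w t\<bar> \<le> M"
    and "A > 0" and "C > 0" and "\<alpha> > 0"
    and "C1 = min Fs Fc"
    and "K1 = (\<lambda>t. C * \<sigma>0 / (A * J) * (\<sigma>1 * (\<bar>w t\<bar> / h (w t)) - 1))"
    and "K2 = \<alpha> + C / (A * J) * \<sigma>0 * \<sigma>1 * (\<sigma>1 * (M / C1) - 1)"
  shows "(\<forall>zh wh. lugre_observer J \<sigma>0 \<sigma>1 Fv h K1 K2 u w zh wh \<longrightarrow>
            (let ez = (\<lambda>t. z t - zh t); ew = (\<lambda>t. w t - wh t) in
              ew \<in> L_2 \<and> ez \<in> L_2 \<and> (ew \<longlongrightarrow> 0) at_top \<and> (ez \<longlongrightarrow> 0) at_top)) \<and>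
         (\<forall>ez ew. error_dynamics J \<sigma>0 \<sigma>1 h K1 K2 w ez ew \<longrightarrow>
            (ew \<longlongrightarrow> 0) at_top \<and> (ez \<longlongrightarrow> 0) at_top)"
proof -
  have "C1 > 0" using assms by simp
  have h: "C1 \<le> h v" for v
    using stribeck_ge_min assms by simp
  \<comment> \<open>This is where the bound on the velocity enters: \<open>M / C1\<close> plays the
    role of \<open>G\<close>.\<close>
  have g: "0 \<le> \<bar>w t\<bar> / h (w t)" "\<bar>w t\<bar> / h (w t) \<le> M / C1" if "t \<ge> 0" for t
    using h[of "w t"] \<open>C1 > 0\<close> assms that by (auto intro!: frac_le divide_nonneg_nonneg)
  define c where "c = C * \<sigma>0 / (A * J)"
  have c: "c > 0" using assms by (simp add: c_def)
  have K1: "K1 = (\<lambda>t. c * (\<sigma>1 * (\<bar>w t\<bar> / h (w t)) - 1))"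
    using assms by (simp add: c_def)
  have K2: "K2 = \<alpha> + c * \<sigma>1 * (\<sigma>1 * (M / C1) - 1)"
    using assms by (simp add: c_def)
  \<comment> \<open>Stated for every solution of the error system, so that it serves both the
    observer errors and the claim for arbitrary initial conditions.\<close>
  have main: "ew \<in> L_2 \<and> ez \<in> L_2 \<and> (ew \<longlongrightarrow> 0) at_top \<and> (ez \<longlongrightarrow> 0) at_top"
    if err: "error_dynamics J \<sigma>0 \<sigma>1 h K1 K2 w ez ew" for ez ew
  proof -
    obtain B r where "r > 0" and
      B: "\<And>t. t \<ge> 0 \<Longrightarrow> (ez t)\<^sup>2 + (ew t)\<^sup>2 \<le> B * exp (- r * t)"
      using error_dynamics_exponential_decay[OF \<open>J > 0\<close> \<open>\<sigma>0 > 0\<close> \<open>\<sigma>1 > 0\<close> c \<open>\<alpha> > 0\<close> g K1 K2 err]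
      by blast
    have bz: "(ez t)\<^sup>2 \<le> B * exp (- r * t)" and bw: "(ew t)\<^sup>2 \<le> B * exp (- r * t)" if "t \<ge> 0" for t
      using B[OF that] zero_le_power2[of "ez t"] zero_le_power2[of "ew t"] by linarith+
    have "continuous_on {0..} ez" "continuous_on {0..} ew"
      using err unfolding error_dynamics_def
      by (auto intro!: DERIV_continuous_on)
    then show ?thesis
      using quadratic_decay_imp_L_2[OF \<open>r > 0\<close>] quadratic_decay_imp_tendsto_0[OF \<open>r > 0\<close>] bz bw
      by blast
  qed
  show ?thesis
    unfolding Let_def
    using main observer_error_dynamics[OF \<open>J > 0\<close> \<open>lugre_system J \<sigma>0 \<sigma>1 Fv h u w z\<close>] by blast
qed

end
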